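(* The ERI space $(X_0,\tau_{\mathrm{ERI}})$ is sober.
   Context: Let $\overline{\mathbb{R}}=[-\infty,+\infty]$ be the extended real line with its order topology. Let $\sim$ be the equivalence relation on $\overline{\mathbb{R}}$ whose only non-singleton class is $\{-\infty,0,+\infty\}$, let $X_0=\overline{\mathbb{R}}/{\sim}$ be the quotient set, $q\colon\overline{\mathbb{R}}\to X_0$ the projection, and $\ast=q(-\infty)=q(0)=q(+\infty)$. The ERI topology $\tau_{\mathrm{ERI}}$ on $X_0$ consists of all $U\subseteq X_0$ such that (a) $q^{-1}(U)$ is open in $\overline{\mathbb{R}}$, and (b) if $\ast\in U$ then $q^{-1}(U)$ is dense in $\overline{\mathbb{R}}$. (This is a topology.) The ERI space is $X=(X_0,\tau_{\mathrm{ERI}})$. A space is sober if every (nonempty) irreducible closed subset $F$ has a unique generic point, i.e. a unique $x$ with $\overline{\{x\}}=F$; a nonempty closed set $F$ is irreducible if $F=F_1\cup F_2$ with $F_1,F_2$ closed implies $F_1=F$ or $F_2=F$. *)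

theory Defs
  imports "HOL-Analysis.Analysis"
begin

text \<open>
  The type \<^typ>\<open>ereal\<close> carries the order topology of the extended real line.
  Points of the quotient set are equivalence classes, i.e. sets of extended reals.
\<close>

definition eri_rel :: "(ereal \<times> ereal) set" where
  "eri_rel = {(x, y). x = y \<or> (x \<in> {-\<infinity>, 0, \<infinity>} \<and> y \<in> {-\<infinity>, 0, \<infinity>})}"

definition eri_points :: "ereal set set" where
  "eri_points = UNIV // eri_rel"

definition eri_proj :: "ereal \<Rightarrow> ereal set" where
  "eri_proj x = eri_rel `` {x}"

definition eri_star :: "ereal set" where
  "eri_star = eri_proj 0"

definition eri_open :: "ereal set set \<Rightarrow> bool" where
  "eri_open U \<longleftrightarrow> U \<subseteq> eri_points \<and> open (eri_proj -` U) \<and>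
     (eri_star \<in> U \<longrightarrow> closure (eri_proj -` U) = UNIV)"

definition eri_space :: "ereal set topology" where
  "eri_space = topology eri_open"

definition irreducible_closedin :: "'a topology \<Rightarrow> 'a set \<Rightarrow> bool" where
  "irreducible_closedin X F \<longleftrightarrow> closedin X F \<and> F \<noteq> {} \<and>
     (\<forall>F1 F2. closedin X F1 \<and> closedin X F2 \<and> F = F1 \<union> F2 \<longrightarrow> F1 = F \<or> F2 = F)"

definition sober_space :: "'a topology \<Rightarrow> bool" where
  "sober_space X \<longleftrightarrow> (\<forall>F. irreducible_closedin X F \<longrightarrow>
     (\<exists>!x. x \<in> topspace X \<and> X closure_of {x} = F))"

lemma equiv_eri_rel: "equiv UNIV eri_rel"
  by (rule equivI) (auto simp: eri_rel_def refl_on_def sym_def trans_def)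

lemma eri_proj_eq_iff:
  "eri_proj x = eri_proj y \<longleftrightarrow> x = y \<or> (x \<in> {-\<infinity>, 0, \<infinity>} \<and> y \<in> {-\<infinity>, 0, \<infinity>})"
  using eq_equiv_class_iff[OF equiv_eri_rel, of x y] by (auto simp: eri_proj_def eri_rel_def)

lemma eri_star_eq: "eri_proj (-\<infinity>) = eri_star" "eri_proj 0 = eri_star" "eri_proj \<infinity> = eri_star"
  unfolding eri_star_def eri_proj_eq_iff by auto

lemma range_eri_proj: "range eri_proj = eri_points"
  by (auto simp: eri_proj_def eri_points_def quotient_def)

lemma istopology_eri_open: "istopology eri_open"
  unfolding istopology_def
proof (intro conjI allI impI)
  fix S T assume S: "eri_open S" and T: "eri_open T"
  have "closure (eri_proj -` (S \<inter> T)) = UNIV" if star: "eri_star \<in> S \<inter> T"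
  proof -
    have "UNIV = closure (eri_proj -` S)"
      using S star by (auto simp: eri_open_def)
    also have "\<dots> \<subseteq> closure (eri_proj -` S \<inter> closure (eri_proj -` T))"
      using T star by (auto simp: eri_open_def)
    also have "\<dots> \<subseteq> closure (closure (eri_proj -` S \<inter> eri_proj -` T))"
      using S by (intro closure_mono open_Int_closure_subset) (auto simp: eri_open_def)
    finally show ?thesis by auto
  qed
  then show "eri_open (S \<inter> T)"
    using S T by (auto simp: eri_open_def)
next
  fix K assume K: "\<forall>U\<in>K. eri_open U"
  have "closure (eri_proj -` \<Union>K) = UNIV" if star: "eri_star \<in> \<Union>K"
  proof -
    obtain U where U: "U \<in> K" "eri_star \<in> U" using star by blast
    then have "closure (eri_proj -` U) = UNIV" using K by (auto simp: eri_open_def)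
    moreover have "closure (eri_proj -` U) \<subseteq> closure (eri_proj -` \<Union>K)"
      using U by (intro closure_mono) auto
    ultimately show ?thesis by auto
  qed
  moreover have "open (eri_proj -` \<Union>K)"
    using K by (auto simp: eri_open_def vimage_Union)
  ultimately show "eri_open (\<Union>K)"
    using K by (auto simp: eri_open_def)
qed

lemma openin_eri_space: "openin eri_space U \<longleftrightarrow> eri_open U"
  by (simp add: eri_space_def topology_inverse'[OF istopology_eri_open])

lemma topspace_eri_space: "topspace eri_space = eri_points"
proof -
  have "eri_proj -` eri_points = UNIV" using range_eri_proj by auto
  then have "openin eri_space eri_points"
    by (simp add: openin_eri_space eri_open_def)
  then show ?thesis
    unfolding topspace_def openin_eri_space by (auto simp: eri_open_def)
qed

end

theory Submission
  imports Defs
begin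

text \<open>
  The space is \<open>T\<^sub>1\<close>, because deleting one class leaves an open set that is dense whenever it
  contains the star. Away from the star it carries the usual Hausdorff topology, so an irreducible
  closed set contains at most one point other than the star; being irreducible and finite in a
  \<open>T\<^sub>1\<close> space, it is a singleton.
\<close>

text \<open>Otherwise \<open>F - U\<close> and \<open>F - V\<close> would be two closed sets
  covering \<open>F\<close>, both proper since \<open>F\<close> meets \<open>U\<close> and
  \<open>V\<close>.\<close>

lemma irreducible_closedin_openin_Int:
  assumes "irreducible_closedin X F" "openin X U" "openin X V" "F \<inter> U \<noteq> {}" "F \<inter> V \<noteq> {}"
  shows "F \<inter> U \<inter> V \<noteq> {}"
proof
  assume "F \<inter> U \<inter> V = {}"
  then have "F = (F - U) \<union> (F - V)" by blast
  moreover have "closedin X (F - U)" "closedin X (F - V)"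
    using assms by (auto simp: irreducible_closedin_def intro: closedin_diff)
  ultimately have "F - U = F \<or> F - V = F"
    using assms(1) unfolding irreducible_closedin_def by blast
  then show False using assms(4,5) by blast
qed

text \<open>Points of a T1 space are their own closures, so the only possible generic point of
  \<open>{x}\<close> is \<open>x\<close>.\<close>

lemma t1_space_sober_spaceI:
  assumes "t1_space X"
    and "\<And>F. irreducible_closedin X F \<Longrightarrow> \<exists>x. F = {x}"
  shows "sober_space X"
  unfolding sober_space_def
proof (intro allI impI)
  fix F assume F: "irreducible_closedin X F"
  then obtain x where x: "F = {x}" using assms(2) by blast
  then have "x \<in> topspace X"
    using F closedin_subset by (fastforce simp: irreducible_closedin_def)
  moreover have "X closure_of {y} = {y}" if "y \<in> topspace X" for y
    using assms(1) that by (simp add: t1_space_closedin_singleton closure_of_closedin)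
  ultimately show "\<exists>!x. x \<in> topspace X \<and> X closure_of {x} = F"
    using x by auto
qed

lemma eri_proj_eq_star_iff: "eri_proj x = eri_star \<longleftrightarrow> x \<in> {-\<infinity>, 0, \<infinity>}"
  by (auto simp: eri_star_def eri_proj_eq_iff)

text \<open>Pulling back along \<open>ereal\<close> would make a singleton open in the real
  line.\<close>

lemma not_open_singleton_ereal:
  fixes x :: ereal
  assumes "\<bar>x\<bar> \<noteq> \<infinity>"
  shows "\<not> open {x}"
proof
  assume "open {x}"
  obtain r where "x = ereal r" using assms by (cases x) auto
  then have "ereal -` {x} = {r}" by auto
  with \<open>open {x}\<close> have "open {r}" using open_ereal_vimage by metis
  then show False using not_open_singleton by blast
qed

text \<open>This is the source of T1. For the star the density clause is vacuous; any other class is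
  a single finite number, which is not isolated, so its complement is dense.\<close>

lemma openin_eri_space_delete: "openin eri_space (eri_points - {p})"
proof (cases "p \<in> eri_points")
  case False
  then show ?thesis using openin_topspace[of eri_space] by (simp add: topspace_eri_space)
next
  case True
  then obtain x where p: "p = eri_proj x" using range_eri_proj by blast
  have pre: "eri_proj -` (eri_points - {p}) = - (eri_proj -` {p})"
    using range_eri_proj by auto
  have "finite (eri_proj -` {p})"
    \<comment> \<open>The four-element bound covers both kinds of fibre, \<open>{x}\<close> and the
      collapsed triple.\<close>
    by (rule finite_subset[of _ "{x, -\<infinity>, 0, \<infinity>}"]) (auto simp: p eri_proj_eq_iff)
  then have "open (- (eri_proj -` {p}))" by (simp add: finite_imp_closed open_Compl)
  moreover have "closure (- (eri_proj -` {p})) = UNIV" if "p \<noteq> eri_star"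
  proof -
    have x: "x \<notin> {-\<infinity>, 0, \<infinity>}" using that by (simp add: p eri_proj_eq_star_iff)
    then have "eri_proj -` {p} = {x}" by (auto simp: p eri_proj_eq_iff)
    moreover have "interior {x} = {}"
    proof (rule ccontr)
      assume "interior {x} \<noteq> {}"
      then have "interior {x} = {x}" using interior_subset[of "{x}"] by blast
      then have "open {x}" by (metis open_interior)
      moreover have "\<bar>x\<bar> \<noteq> \<infinity>" using x by (cases x) auto
      ultimately show False using not_open_singleton_ereal[of x] by simp
    qed
    ultimately show ?thesis by (simp add: closure_complement)
  qed
  ultimately show ?thesis by (auto simp: openin_eri_space eri_open_def pre)
qed

lemma t1_space_eri_space: "t1_space eri_space"
  unfolding t1_space_closedin_singleton topspace_eri_space
  using openin_eri_space_delete by (simp add: closedin_def topspace_eri_space)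

lemma openin_eri_space_image:
  assumes "open A" "A \<inter> {-\<infinity>, 0, \<infinity>} = {}"
  shows "openin eri_space (eri_proj ` A)"
proof -
  have "eri_proj -` eri_proj ` A = A"
    using assms(2) by (auto simp: eri_proj_eq_iff)
  moreover have "eri_star \<notin> eri_proj ` A"
    using assms(2) eri_proj_eq_star_iff by (metis IntI empty_iff imageE)
  ultimately show ?thesis
    using assms(1) range_eri_proj by (auto simp: openin_eri_space eri_open_def)
qed

lemma eri_space_separation:
  assumes "p \<in> eri_points" "q \<in> eri_points" "p \<noteq> q" "p \<noteq> eri_star" "q \<noteq> eri_star"
  obtains U V where "openin eri_space U" "openin eri_space V" "p \<in> U" "q \<in> V" "U \<inter> V = {}"
proof -
  obtain x y where xy: "p = eri_proj x" "q = eri_proj y"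
    using assms(1,2) unfolding range_eri_proj[symmetric] by (elim rangeE) simp
  then have "x \<noteq> y" using assms by auto
  then obtain A B where AB: "open A" "open B" "x \<in> A" "y \<in> B" "A \<inter> B = {}"
    using hausdorff by metis
  \<comment> \<open>Removing this finite closed set keeps \<open>A\<close> and \<open>B\<close>
    open, and \<open>x\<close> and \<open>y\<close> survive because \<open>p\<close> and
    \<open>q\<close> differ from the star.\<close>
  let ?S = "{-\<infinity>, 0, \<infinity>} :: ereal set"
  have "open (A - ?S)" "open (B - ?S)"
    using AB by (auto intro!: open_Diff finite_imp_closed)
  then have "openin eri_space (eri_proj ` (A - ?S))" "openin eri_space (eri_proj ` (B - ?S))"
    by (auto intro: openin_eri_space_image)
  moreover have "p \<in> eri_proj ` (A - ?S)" "q \<in> eri_proj ` (B - ?S)"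
    using AB xy assms by (auto simp: eri_proj_eq_star_iff)
  moreover have "eri_proj ` (A - ?S) \<inter> eri_proj ` (B - ?S) = {}"
    using AB by (auto simp: eri_proj_eq_iff)
  ultimately show ?thesis using that by blast
qed

lemma irreducible_closedin_eri_space_singleton:
  assumes F: "irreducible_closedin eri_space F"
  shows "\<exists>p. F = {p}"
proof -
  have sub: "F \<subseteq> eri_points"
    using F closedin_subset topspace_eri_space by (fastforce simp: irreducible_closedin_def)
  have unique: "p = q" if pq: "p \<in> F" "q \<in> F" "p \<noteq> eri_star" "q \<noteq> eri_star" for p q
  proof (rule ccontr)
    assume "p \<noteq> q"
    then obtain U V where UV: "openin eri_space U" "openin eri_space V"
        "p \<in> U" "q \<in> V" "U \<inter> V = {}"
      using eri_space_separation[OF subsetD[OF sub pq(1)] subsetD[OF sub pq(2)]] pq(3,4)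
      by metis
    then have "F \<inter> U \<inter> V \<noteq> {}"
      using pq(1,2) by (intro irreducible_closedin_openin_Int[OF F UV(1,2)]) blast+
    with UV(5) show False by blast
  qed
  \<comment> \<open>Separation says nothing about the star, so T1 is used instead: the complements
    of \<open>p\<close> and of the star both meet \<open>F\<close>, hence \<open>F\<close> has a
    third point, against \<open>unique\<close>.\<close>
  have star: "p = eri_star" if "p \<in> F" "eri_star \<in> F" for p
  proof (rule ccontr)
    assume p: "p \<noteq> eri_star"
    have "F \<inter> (eri_points - {p}) \<inter> (eri_points - {eri_star}) \<noteq> {}"
    proof (rule irreducible_closedin_openin_Int[OF F])
      show "F \<inter> (eri_points - {p}) \<noteq> {}" using that(2) sub p by blast
      show "F \<inter> (eri_points - {eri_star}) \<noteq> {}" using that(1) sub p by blast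
    qed (rule openin_eri_space_delete)+
    then obtain q where "q \<in> F" "q \<noteq> p" "q \<noteq> eri_star" by blast
    then show False using unique[OF that(1) _ p] by metis
  qed
  obtain p where p: "p \<in> F" using F by (auto simp: irreducible_closedin_def)
  have "q = p" if "q \<in> F" for q
  proof (cases "eri_star \<in> F")
    case True
    then show ?thesis using star[OF p] star[OF that] by simp
  next
    case False
    then show ?thesis using p that by (intro unique) auto
  qed
  then show ?thesis using p by blast
qed

theorem theorem4p13:
  shows "sober_space eri_space"
  using t1_space_eri_space irreducible_closedin_eri_space_singleton
  by (rule t1_space_sober_spaceI)

end
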